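(* Let $L$ and $L'$ be 4-component links represented by the 12-tuples of integers $(c_1,\dots,c_6,f_1,\dots,f_4,t_1,t_2)$ and $(c'_1,\dots,c'_6,f'_1,\dots,f'_4,t'_1,t'_2)$ respectively. Suppose that both tuples satisfy the hypotheses of the same item among (1)–(5) below. Then $L$ and $L'$ are link-homotopic (equivalently, the two tuples define the same element of $N$) if and only if all the quantities listed in that item take the same value on the two tuples. That is, the listed quantities form a complete set of invariants for the corresponding subset of link-homotopy classes. A quantity listed without a modulus is compared as an integer; a quantity listed with a modulus is compared as a residue class. (1) Hypotheses: $c_2=c_4=c_5=c_6=0$, $c_1,c_3\neq 0$, $f_1\equiv 0 \pmod{c_1}$ and $f_3\equiv 0\pmod{c_3}$. Quantities: $c_1$; $c_3$; $f_2$; $f_4 \pmod{\gcd(c_1,c_3)}$; $\Delta_1=c_1t_1+f_1f_4 \pmod{c_1\gcd(c_3,f_2)}$; $\Delta_2=c_3t_2+f_3f_4 \pmod{c_3\gcd(c_1,f_2)}$. (2) Hypotheses: $c_2=c_4=c_5=c_6=0$, $c_1=c_3\neq 0$, $f_1\equiv 0\pmod{\gcd(c_1,f_2,f_3)}$ and $f_3\equiv 0\pmod{\gcd(c_1,f_1,f_2)}$. Quantities: $c_1$; $f_1\pmod{c_1}$; $f_3\pmod{c_1}$; $f_2$; $f_4\pmod{c_1}$; $\Delta_1=c_1t_1+f_1f_4\pmod{c_1\gcd(c_1,f_1,f_2,f_3)}$; $\Delta_2=c_1t_2+f_3f_4\pmod{c_1\gcd(c_1,f_1,f_2,f_3)}$.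 (3) Hypotheses: $c_2=c_5=c_6=0$, $c_1,c_3,c_4\neq 0$ and $\gcd(c_1,c_3)=\gcd(c_3,c_4)=1$. Quantities: $c_1$; $c_3$; $c_4$; $f_1\pmod{c_1}$; $f_2\pmod{c_4}$; $\Delta_2=c_3t_2+f_3f_4\pmod{\gcd(c_1,c_4,c_3f_1,c_3f_2)}$; $\Delta_3=c_1c_4t_1+c_4f_1f_4+c_1f_2f_3\pmod{c_3}$. (4) Hypotheses: $c_3=c_6=0$, $c_1,c_2,c_4,c_5\neq 0$ and $\gcd(c_1,c_4)=\gcd(c_2,c_5)=1$. Quantities: $c_1$; $c_2$; $c_4$; $c_5$; $f_1\pmod{\gcd(c_1,c_5)}$; $f_2\pmod{\gcd(c_2,c_4)}$; $f_3\pmod{\gcd(c_4,c_5)}$; $f_4\pmod{\gcd(c_1,c_2)}$. (5) Hypotheses: $c_5=c_6=0$, $c_1,c_2,c_3,c_4\neq 0$, and either $\gcd(c_1,c_4)=\gcd(c_2,c_3)=\gcd(c_2,c_4)=1$ or $\gcd(c_1,c_3)=\gcd(c_2,c_3)=\gcd(c_2,c_4)=1$. Quantities: $c_1$; $c_2$; $c_3$; $c_4$; $f_1\pmod{c_1}$; $\Delta_4=c_1c_2f_3+c_1c_3f_2+c_2c_3f_1\pmod{c_1c_4}$.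
   Context: Links are ordered, oriented, piecewise linear links in $S^3$. Two links are link-homotopic if one is transformed into the other by a sequence of self-crossing changes (crossing changes between arcs of the same component) and ambient isotopies. $\mathcal{L}_4$ denotes the set of link-homotopy classes of 4-component links. $N$ is the quotient of the set of 12-tuples of integers $(c_1,\dots,c_6,f_1,\dots,f_4,t_1,t_2)$ by the equivalence relation generated by the following moves (integers not mentioned are unchanged): $\psi_{21}$: $f_3\mapsto f_3+c_5,\ f_4\mapsto f_4-c_1,\ t_1\mapsto t_1+f_1$; $\psi_{41}$: $f_2\mapsto f_2+c_6,\ f_3\mapsto f_3-c_5,\ t_2\mapsto t_2-f_1$; $\psi_{12}$: $f_3\mapsto f_3-c_4,\ f_4\mapsto f_4+c_2,\ t_1\mapsto t_1+f_2$; $\psi_{32}$: $f_1\mapsto f_1+c_6,\ f_4\mapsto f_4-c_2,\ t_2\mapsto t_2-f_2$; $\psi_{43}$: $f_1\mapsto f_1+c_5,\ f_2\mapsto f_2-c_4,\ t_1\mapsto t_1+f_3$; $\psi_{23}$: $f_1\mapsto f_1-c_5,\ f_4\mapsto f_4+c_3,\ t_2\mapsto t_2-f_3$; $\psi_{34}$: $f_1\mapsto f_1-c_1,\ f_2\mapsto f_2+c_2,\ t_1\mapsto t_1+f_4$; $\psi_{14}$: $f_2\mapsto f_2-c_2,\ f_3\mapsto f_3+c_3,\ t_2\mapsto t_2-f_4$. Every 4-component link is link-homotopic to one in standard form, obtained by surgery on the trivial 4-component link (components regarded as vertices $1,2,3,4$ of a tetrahedron) along parallel simple tree claspers (in the sense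 of Habiro): $C_1$-trees (two leaves) on the edges, with numbers $c_1$ (edge $23$), $c_2$ ($13$), $c_3$ ($12$), $c_4$ ($14$), $c_5$ ($24$), $c_6$ ($34$); $C_2$-trees (three leaves) on the faces, with numbers $f_1$ (face $234$), $f_2$ ($134$), $f_3$ ($124$), $f_4$ ($123$); and two fixed types of $C_3$-trees (four leaves, one on each component), with numbers $t_1,t_2$; negative numbers mean half-twisted trees. A link is represented by a 12-tuple if it is link-homotopic to the standard form with these numbers of claspers. The map sending a 12-tuple to the link-homotopy class of its standard form induces a bijection $N\to\mathcal{L}_4$. Hence two links represented by given tuples are link-homotopic if and only if the tuples define the same element of $N$. $\gcd$ denotes the (positive) greatest common divisor of integers that are not all zero. In each item, the moduli that involve the $f_i$ depend only on the $c_i$ and on the quantities of the list involving $f_i$ that come earlier in the list, so they are the same for two tuples on which those earlier quantities agree. *)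

theory Defs
  imports "HOL-Analysis.Analysis" "HOL-Number_Theory.Cong"
begin

section \<open>Piecewise linear links in the 3-sphere\<close>

text \<open>On compact polyhedra: affine on each simplex of some finite triangulation.\<close>

definition piecewise_linear_on ::
    "'a::euclidean_space set \<Rightarrow> ('a \<Rightarrow> 'b::euclidean_space) \<Rightarrow> bool" where
  "piecewise_linear_on S f \<longleftrightarrow>
     (\<exists>\<T>. triangulation \<T> \<and> \<Union>\<T> = S \<and>
        (\<forall>\<sigma>\<in>\<T>. \<exists>A b. linear A \<and> (\<forall>x\<in>\<sigma>. f x = A x + b)))"

text \<open>The standard PL 3-sphere is modelled as the boundary of the 4-cube, since the round
  sphere is not a polyhedron.\<close>

definition S3 :: "(real^4) set" where
  "S3 = frontier (cbox (-1) 1)"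

text \<open>A 4-component link is a family of parametrised closed curves; the numeral type \<open>4\<close>
  serves as the ordered set of components. Parametrisations carry the orientations and are
  divided out (by orientation preserving reparametrisation only) in \<open>same_oriented_curve\<close>.\<close>

type_synonym link4 = "4 \<Rightarrow> real \<Rightarrow> real^4"

definition links :: "link4 set" where
  "links = {L.
     (\<forall>i. piecewise_linear_on {0..1} (L i) \<and> simple_path (L i) \<and>
          pathfinish (L i) = pathstart (L i) \<and> path_image (L i) \<subseteq> S3) \<and>
     (\<forall>i j. i \<noteq> j \<longrightarrow> path_image (L i) \<inter> path_image (L j) = {})}"

text \<open>\<open>\<phi>\<close> is the lift to the real line of an orientation preserving homeomorphism of the
  circle \<open>\<real>/\<int>\<close>; the base point may move.\<close>

definition same_oriented_curve :: "(real \<Rightarrow> real^4) \<Rightarrow> (real \<Rightarrow> real^4) \<Rightarrow> bool" where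
  "same_oriented_curve g g' \<longleftrightarrow>
     (\<exists>\<phi> :: real \<Rightarrow> real. continuous_on UNIV \<phi> \<and> strict_mono \<phi> \<and>
        (\<forall>t. \<phi> (t + 1) = \<phi> t + 1) \<and> (\<forall>t\<in>{0..1}. g' t = g (frac (\<phi> t))))"

definition PL_ambient_isotopy :: "((real^4) \<times> real \<Rightarrow> real^4) \<Rightarrow> bool" where
  "PL_ambient_isotopy F \<longleftrightarrow>
     piecewise_linear_on (S3 \<times> {0..1}) F \<and>
     (\<forall>t\<in>{0..1}. bij_betw (\<lambda>x. F (x, t)) S3 S3) \<and>
     (\<forall>x\<in>S3. F (x, 0) = x)"

definition ambient_isotopic :: "link4 \<Rightarrow> link4 \<Rightarrow> bool" where
  "ambient_isotopic L L' \<longleftrightarrow>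
     (\<exists>F. PL_ambient_isotopy F \<and> (\<forall>i. same_oriented_curve (\<lambda>t. F (L i t, 1)) (L' i)))"

text \<open>The model crossing in the cube \<open>[-1,1]\<^sup>3\<close>: a straight strand along the first axis, and
  a strand joining the points \<open>(0,-1,0)\<close> and \<open>(0,1,0)\<close> that passes over it
  (\<open>\<epsilon> = 1\<close>) or under it (\<open>\<epsilon> = -1\<close>).\<close>

definition crossing :: "real \<Rightarrow> (real^3) set" where
  "crossing \<epsilon> =
     closed_segment (vector [-1, 0, 0]) (vector [1, 0, 0]) \<union>
     closed_segment (vector [0, -1, 0]) (vector [0, 0, \<epsilon> / 2]) \<union>
     closed_segment (vector [0, 0, \<epsilon> / 2]) (vector [0, 1, 0])"

text \<open>The links agree outside an embedded PL ball \<open>h ` [-1,1]\<^sup>3\<close> that meets component \<open>i\<close>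
  only, in the model crossing, and the crossing is switched. Both strands belong to
  component \<open>i\<close>. Agreement of the parametrisations outside the ball makes the orientations of
  the two links match. The sign of the crossing is not restricted, as \<open>h\<close> may be composed with
  a reflection of the cube.\<close>

definition self_crossing_change :: "link4 \<Rightarrow> link4 \<Rightarrow> bool" where
  "self_crossing_change L L' \<longleftrightarrow>
     (\<exists>i h B. piecewise_linear_on (cbox (-1) 1) h \<and> inj_on h (cbox (-1) 1) \<and>
        B = h ` cbox (-1) 1 \<and> B \<subseteq> S3 \<and>
        path_image (L i) \<inter> B = h ` crossing 1 \<and>
        path_image (L' i) \<inter> B = h ` crossing (-1) \<and>
        (\<forall>t\<in>{0..1}. L i t \<notin> B \<or> L' i t \<notin> B \<longrightarrow> L i t = L' i t) \<and>
        (\<forall>j. j \<noteq> i \<longrightarrow> path_image (L j) \<inter> B = {} \<and> (\<forall>t\<in>{0..1}. L j t = L' j t)))"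

definition link_homotopy_step :: "link4 \<Rightarrow> link4 \<Rightarrow> bool" where
  "link_homotopy_step L L' \<longleftrightarrow>
     L \<in> links \<and> L' \<in> links \<and> (ambient_isotopic L L' \<or> self_crossing_change L L')"

definition link_homotopic :: "link4 \<Rightarrow> link4 \<Rightarrow> bool" where
  "link_homotopic L L' \<longleftrightarrow> L \<in> links \<and> L' \<in> links \<and> equivclp link_homotopy_step L L'"

definition link_homotopy_class :: "link4 \<Rightarrow> link4 set" where
  "link_homotopy_class L = {(L, L'). link_homotopic L L'} `` {L}"

definition L4 :: "link4 set set" where
  "L4 = links // {(L, L'). link_homotopic L L'}"


section \<open>The set \<open>N\<close>\<close>

record tuple12 =
  c1 :: int  c2 :: int  c3 :: int  c4 :: int  c5 :: int  c6 :: int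
  f1 :: int  f2 :: int  f3 :: int  f4 :: int
  t1 :: int  t2 :: int

definition \<psi>21 :: "tuple12 \<Rightarrow> tuple12" where
  "\<psi>21 q = q\<lparr>f3 := f3 q + c5 q, f4 := f4 q - c1 q, t1 := t1 q + f1 q\<rparr>"
definition \<psi>41 :: "tuple12 \<Rightarrow> tuple12" where
  "\<psi>41 q = q\<lparr>f2 := f2 q + c6 q, f3 := f3 q - c5 q, t2 := t2 q - f1 q\<rparr>"
definition \<psi>12 :: "tuple12 \<Rightarrow> tuple12" where
  "\<psi>12 q = q\<lparr>f3 := f3 q - c4 q, f4 := f4 q + c2 q, t1 := t1 q + f2 q\<rparr>"
definition \<psi>32 :: "tuple12 \<Rightarrow> tuple12" where
  "\<psi>32 q = q\<lparr>f1 := f1 q + c6 q, f4 := f4 q - c2 q, t2 := t2 q - f2 q\<rparr>"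
definition \<psi>43 :: "tuple12 \<Rightarrow> tuple12" where
  "\<psi>43 q = q\<lparr>f1 := f1 q + c5 q, f2 := f2 q - c4 q, t1 := t1 q + f3 q\<rparr>"
definition \<psi>23 :: "tuple12 \<Rightarrow> tuple12" where
  "\<psi>23 q = q\<lparr>f1 := f1 q - c5 q, f4 := f4 q + c3 q, t2 := t2 q - f3 q\<rparr>"
definition \<psi>34 :: "tuple12 \<Rightarrow> tuple12" where
  "\<psi>34 q = q\<lparr>f1 := f1 q - c1 q, f2 := f2 q + c2 q, t1 := t1 q + f4 q\<rparr>"
definition \<psi>14 :: "tuple12 \<Rightarrow> tuple12" where
  "\<psi>14 q = q\<lparr>f2 := f2 q - c2 q, f3 := f3 q + c3 q, t2 := t2 q - f4 q\<rparr>"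

definition N_move :: "tuple12 \<Rightarrow> tuple12 \<Rightarrow> bool" where
  "N_move q q' \<longleftrightarrow> q' \<in> {\<psi>21 q, \<psi>41 q, \<psi>12 q, \<psi>32 q, \<psi>43 q, \<psi>23 q, \<psi>34 q, \<psi>14 q}"

definition N_rel :: "tuple12 rel" where
  "N_rel = {(q, q'). equivclp N_move q q'}"

definition N :: "tuple12 set set" where
  "N = UNIV // N_rel"

definition N_class :: "tuple12 \<Rightarrow> tuple12 set" where
  "N_class q = N_rel `` {q}"


section \<open>Links represented by tuples\<close>

text \<open>The clasper construction of the standard form enters only through a map \<open>std\<close> from tuples
  to links and the classification theorem for it, namely that \<open>std\<close> induces a bijection from
  \<open>N\<close> onto the link-homotopy classes.\<close>

definition induces_bijection :: "(tuple12 \<Rightarrow> link4) \<Rightarrow> bool" where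
  "induces_bijection std \<longleftrightarrow>
     (\<forall>q. std q \<in> links) \<and>
     (\<exists>\<Phi>. bij_betw \<Phi> N L4 \<and> (\<forall>q. \<Phi> (N_class q) = link_homotopy_class (std q)))"

definition represented_by :: "(tuple12 \<Rightarrow> link4) \<Rightarrow> link4 \<Rightarrow> tuple12 \<Rightarrow> bool" where
  "represented_by std L q \<longleftrightarrow> link_homotopic L (std q)"

text \<open>\<open>P\<close> is the hypothesis on tuples, \<open>Q\<close> the list of quantities. The first conjunct is the
  statement in \<open>N\<close> and does not involve \<open>std\<close>; the second is the statement about links.\<close>

definition complete_invariants :: "(tuple12 \<Rightarrow> bool) \<Rightarrow> (tuple12 \<Rightarrow> 'a) \<Rightarrow> bool" where
  "complete_invariants P Q \<longleftrightarrow>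
     (\<forall>q q'. P q \<and> P q' \<longrightarrow>
        (N_class q = N_class q' \<longleftrightarrow> Q q = Q q') \<and>
        (\<forall>std L L'. induces_bijection std \<and> represented_by std L q \<and> represented_by std L' q' \<longrightarrow>
           (link_homotopic L L' \<longleftrightarrow> Q q = Q q')))"

text \<open>Residue classes are sets of integers, so that quantities with a modulus that depends on
  the tuple can be compared by equality.\<close>

definition residue_class :: "int \<Rightarrow> int \<Rightarrow> int set" (\<open>_ modulo _\<close> [51, 51] 50) where
  "(a modulo m) = {b. [b = a] (mod m)}"

end

theory Submission
  imports Defs
begin

text \<open>Each move translates \<open>(f\<^sub>1, \<dots>, f\<^sub>4)\<close> by a vector that depends only on the \<open>c\<^sub>i\<close>, and it adds
  plus or minus one of the \<open>f\<^sub>i\<close> to \<open>t\<^sub>1\<close> or \<open>t\<^sub>2\<close>. For completeness, the \<open>f\<^sub>i\<close> are matched by a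
  product of moves whose exponents come from Bezout's identity. The remaining difference in
  \<open>(t\<^sub>1, t\<^sub>2)\<close> is then removed by commutators of moves, which translate \<open>(t\<^sub>1, t\<^sub>2)\<close> by \<open>(c\<^sub>3, 0)\<close>,
  \<open>(0, c\<^sub>1)\<close>, \<open>(0, c\<^sub>4)\<close>, \<open>(c\<^sub>2, -c\<^sub>2)\<close> and \<open>(c\<^sub>5, -c\<^sub>5)\<close>, together with those moves that change
  \<open>t\<^sub>1\<close> or \<open>t\<^sub>2\<close> only; the invariants \<open>\<Delta>\<^sub>i\<close> say that the difference is a combination of these.\<close>

section \<open>Equivalence of tuples and its relation to link-homotopy\<close>

abbreviation N_equiv :: "tuple12 \<Rightarrow> tuple12 \<Rightarrow> bool" (infix \<open>\<sim>\<^sub>N\<close> 50) where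
  "q \<sim>\<^sub>N q' \<equiv> equivclp N_move q q'"

lemmas \<psi>_defs = \<psi>21_def \<psi>41_def \<psi>12_def \<psi>32_def \<psi>43_def \<psi>23_def \<psi>34_def \<psi>14_def

lemma N_equiv_sym: "q \<sim>\<^sub>N q' \<Longrightarrow> q' \<sim>\<^sub>N q"
  by (rule equivclp_sym)

lemma N_equiv_trans [trans]: "q \<sim>\<^sub>N r \<Longrightarrow> r \<sim>\<^sub>N s \<Longrightarrow> q \<sim>\<^sub>N s"
  by (rule equivclp_trans)

lemma N_class_eq_iff: "N_class q = N_class q' \<longleftrightarrow> q \<sim>\<^sub>N q'"
  unfolding N_class_def N_rel_def
  by (auto intro: N_equiv_sym N_equiv_trans)

lemma link_homotopic_sym: "link_homotopic L L' \<Longrightarrow> link_homotopic L' L"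
  unfolding link_homotopic_def by (auto intro: equivclp_sym)

lemma link_homotopic_trans:
  "link_homotopic L L' \<Longrightarrow> link_homotopic L' L'' \<Longrightarrow> link_homotopic L L''"
  unfolding link_homotopic_def by (auto intro: equivclp_trans)

lemma link_homotopy_class_eq_iff:
  assumes "L \<in> links"
  shows "link_homotopy_class L = link_homotopy_class L' \<longleftrightarrow> link_homotopic L L'"
proof
  have "link_homotopic L L"
    using assms by (simp add: link_homotopic_def)
  then show "link_homotopy_class L = link_homotopy_class L' \<Longrightarrow> link_homotopic L L'"
    unfolding link_homotopy_class_def by (auto intro: link_homotopic_sym)
  show "link_homotopic L L' \<Longrightarrow> link_homotopy_class L = link_homotopy_class L'"
    unfolding link_homotopy_class_def
    by (auto intro: link_homotopic_sym link_homotopic_trans)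
qed

text \<open>Both links may be replaced by their standard forms; injectivity of the induced map on
  \<open>N\<close> does the rest. This is the only place where links enter, so all later work is
  about \<open>N_move\<close>.\<close>

lemma link_homotopic_iff_N_class_eq:
  assumes "induces_bijection std" "represented_by std L q" "represented_by std L' q'"
  shows "link_homotopic L L' \<longleftrightarrow> N_class q = N_class q'"
proof -
  obtain \<Phi> where bij: "bij_betw \<Phi> N L4"
    and \<Phi>: "\<And>q. \<Phi> (N_class q) = link_homotopy_class (std q)"
    using assms(1) unfolding induces_bijection_def by blast
  have N: "N_class q \<in> N" for q
    unfolding N_class_def N_def by (rule quotientI) simp
  have "link_homotopic L L' \<longleftrightarrow> link_homotopic (std q) (std q')"
    using assms(2,3) unfolding represented_by_def
    by (blast intro: link_homotopic_sym link_homotopic_trans)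
  also have "\<dots> \<longleftrightarrow> \<Phi> (N_class q) = \<Phi> (N_class q')"
    using assms(1) unfolding \<Phi>
    by (simp add: link_homotopy_class_eq_iff induces_bijection_def)
  also have "\<dots> \<longleftrightarrow> N_class q = N_class q'"
    using bij_betw_imp_inj_on[OF bij] N by (simp add: inj_on_eq_iff)
  finally show ?thesis .
qed

section \<open>Powers of moves and translations of the face numbers\<close>

lemma int_iterate_N_equiv:
  fixes g :: "int \<Rightarrow> tuple12"
  assumes step: "\<And>k. N_move (g k) (g (k + 1))"
  shows "g 0 \<sim>\<^sub>N g k"
proof (induction k rule: int_induct[where k = 0])
  case base
  show ?case by simp
next
  case (step1 i)
  with step[of i] show ?case by (blast intro: N_equiv_trans r_into_equivclp)
next
  case (step2 i)
  \<comment> \<open>Negative powers come from reading a move backwards, which the generated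
    equivalence permits.\<close>
  have "g i \<sim>\<^sub>N g (i - 1)"
    using step[of "i - 1"] by (simp add: N_equiv_sym r_into_equivclp)
  with step2 show ?case by (blast intro: N_equiv_trans)
qed

text \<open>The edge numbers stay those of a fixed \<open>q\<close> while the other six entries are
  explicit. Chains of moves then compose by unification of these entries.\<close>

definition with_ft :: "tuple12 \<Rightarrow> int \<Rightarrow> int \<Rightarrow> int \<Rightarrow> int \<Rightarrow> int \<Rightarrow> int \<Rightarrow> tuple12" where
  "with_ft q x1 x2 x3 x4 y1 y2 = q\<lparr>f1 := x1, f2 := x2, f3 := x3, f4 := x4, t1 := y1, t2 := y2\<rparr>"

lemma with_ft_eq_update_t: "with_ft q (f1 q) (f2 q) (f3 q) (f4 q) x y = q\<lparr>t1 := x, t2 := y\<rparr>"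
  by (simp add: with_ft_def)

text \<open>The change of \<open>t1\<close> is linear in \<open>k\<close> because the face number
  that is added, \<open>f1\<close>, is fixed by the move itself. The same holds for each of the
  other seven moves.\<close>

lemma N_equiv_\<psi>21:
  "with_ft q x1 x2 x3 x4 y1 y2 \<sim>\<^sub>N
   with_ft q x1 x2 (x3 + k * c5 q) (x4 - k * c1 q) (y1 + k * x1) y2"
  using int_iterate_N_equiv[of "\<lambda>k. with_ft q x1 x2 (x3 + k * c5 q) (x4 - k * c1 q) (y1 + k * x1) y2" k]
  by (simp add: with_ft_def N_move_def \<psi>21_def algebra_simps)

lemma N_equiv_\<psi>41:
  "with_ft q x1 x2 x3 x4 y1 y2 \<sim>\<^sub>N
   with_ft q x1 (x2 + k * c6 q) (x3 - k * c5 q) x4 y1 (y2 - k * x1)"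
  using int_iterate_N_equiv[of "\<lambda>k. with_ft q x1 (x2 + k * c6 q) (x3 - k * c5 q) x4 y1 (y2 - k * x1)" k]
  by (simp add: with_ft_def N_move_def \<psi>41_def algebra_simps)

lemma N_equiv_\<psi>12:
  "with_ft q x1 x2 x3 x4 y1 y2 \<sim>\<^sub>N
   with_ft q x1 x2 (x3 - k * c4 q) (x4 + k * c2 q) (y1 + k * x2) y2"
  using int_iterate_N_equiv[of "\<lambda>k. with_ft q x1 x2 (x3 - k * c4 q) (x4 + k * c2 q) (y1 + k * x2) y2" k]
  by (simp add: with_ft_def N_move_def \<psi>12_def algebra_simps)

lemma N_equiv_\<psi>32:
  "with_ft q x1 x2 x3 x4 y1 y2 \<sim>\<^sub>N
   with_ft q (x1 + k * c6 q) x2 x3 (x4 - k * c2 q) y1 (y2 - k * x2)"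
  using int_iterate_N_equiv[of "\<lambda>k. with_ft q (x1 + k * c6 q) x2 x3 (x4 - k * c2 q) y1 (y2 - k * x2)" k]
  by (simp add: with_ft_def N_move_def \<psi>32_def algebra_simps)

lemma N_equiv_\<psi>43:
  "with_ft q x1 x2 x3 x4 y1 y2 \<sim>\<^sub>N
   with_ft q (x1 + k * c5 q) (x2 - k * c4 q) x3 x4 (y1 + k * x3) y2"
  using int_iterate_N_equiv[of "\<lambda>k. with_ft q (x1 + k * c5 q) (x2 - k * c4 q) x3 x4 (y1 + k * x3) y2" k]
  by (simp add: with_ft_def N_move_def \<psi>43_def algebra_simps)

lemma N_equiv_\<psi>23:
  "with_ft q x1 x2 x3 x4 y1 y2 \<sim>\<^sub>N
   with_ft q (x1 - k * c5 q) x2 x3 (x4 + k * c3 q) y1 (y2 - k * x3)"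
  using int_iterate_N_equiv[of "\<lambda>k. with_ft q (x1 - k * c5 q) x2 x3 (x4 + k * c3 q) y1 (y2 - k * x3)" k]
  by (simp add: with_ft_def N_move_def \<psi>23_def algebra_simps)

lemma N_equiv_\<psi>34:
  "with_ft q x1 x2 x3 x4 y1 y2 \<sim>\<^sub>N
   with_ft q (x1 - k * c1 q) (x2 + k * c2 q) x3 x4 (y1 + k * x4) y2"
  using int_iterate_N_equiv[of "\<lambda>k. with_ft q (x1 - k * c1 q) (x2 + k * c2 q) x3 x4 (y1 + k * x4) y2" k]
  by (simp add: with_ft_def N_move_def \<psi>34_def algebra_simps)

lemma N_equiv_\<psi>14:
  "with_ft q x1 x2 x3 x4 y1 y2 \<sim>\<^sub>N
   with_ft q x1 (x2 - k * c2 q) (x3 + k * c3 q) x4 y1 (y2 - k * x4)"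
  using int_iterate_N_equiv[of "\<lambda>k. with_ft q x1 (x2 - k * c2 q) (x3 + k * c3 q) x4 y1 (y2 - k * x4)" k]
  by (simp add: with_ft_def N_move_def \<psi>14_def algebra_simps)

text \<open>The translations of the face numbers commute, so only the exponents matter; the effect
  on \<open>t1\<close> and \<open>t2\<close> depends on the order and is left open. Positional
  instantiation after \<open>q'\<close> and \<open>q\<close> follows first occurrence:
  \<open>k32\<close>, \<open>k43\<close>, \<open>k23\<close>, \<open>k34\<close>,
  \<open>k41\<close>, \<open>k14\<close>, \<open>k21\<close>, \<open>k12\<close>.\<close>

lemma f_translate:
  assumes "c1 q' = c1 q" "c2 q' = c2 q" "c3 q' = c3 q" "c4 q' = c4 q" "c5 q' = c5 q" "c6 q' = c6 q"
    and "f1 q' = f1 q + k32 * c6 q + k43 * c5 q - k23 * c5 q - k34 * c1 q"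
    and "f2 q' = f2 q + k41 * c6 q - k43 * c4 q + k34 * c2 q - k14 * c2 q"
    and "f3 q' = f3 q + k21 * c5 q - k41 * c5 q - k12 * c4 q + k14 * c3 q"
    and "f4 q' = f4 q - k21 * c1 q + k12 * c2 q - k32 * c2 q + k23 * c3 q"
  shows "\<exists>x y. q \<sim>\<^sub>N q'\<lparr>t1 := x, t2 := y\<rparr>"
proof -
  have "q = with_ft q (f1 q) (f2 q) (f3 q) (f4 q) (t1 q) (t2 q)"
    by (simp add: with_ft_def)
  also note N_equiv_\<psi>21[of _ _ _ _ _ _ _ k21]
  also note N_equiv_\<psi>41[of _ _ _ _ _ _ _ k41]
  also note N_equiv_\<psi>12[of _ _ _ _ _ _ _ k12]
  also note N_equiv_\<psi>32[of _ _ _ _ _ _ _ k32]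
  also note N_equiv_\<psi>43[of _ _ _ _ _ _ _ k43]
  also note N_equiv_\<psi>23[of _ _ _ _ _ _ _ k23]
  also note N_equiv_\<psi>34[of _ _ _ _ _ _ _ k34]
  also note N_equiv_\<psi>14[of _ _ _ _ _ _ _ k14]
  finally obtain x y where
    "q \<sim>\<^sub>N with_ft q (f1 q') (f2 q') (f3 q') (f4 q') x y"
    using assms(7-10) by (simp add: algebra_simps)
  moreover have "with_ft q (f1 q') (f2 q') (f3 q') (f4 q') x y = q'\<lparr>t1 := x, t2 := y\<rparr>"
    using assms(1-6) by (simp add: with_ft_def)
  ultimately show ?thesis by auto
qed

section \<open>Commutators of moves\<close>

text \<open>Between the two uses of \<open>\<psi>43\<close>, which add and subtract
  \<open>f3\<close>, the value of \<open>f3\<close> differs by \<open>k * c3 q\<close> because of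
  \<open>\<psi>14\<close>. The contributions of \<open>\<psi>14\<close> to \<open>t2\<close> cancel,
  since \<open>\<psi>43\<close> fixes \<open>f4\<close>.\<close>

lemma t1_add_c3:
  "with_ft q x1 x2 x3 x4 y1 y2 \<sim>\<^sub>N with_ft q x1 x2 x3 x4 (y1 + k * c3 q) y2"
proof -
  note N_equiv_\<psi>14[of q x1 x2 x3 x4 y1 y2 k]
  also note N_equiv_\<psi>43[of _ _ _ _ _ _ _ 1]
  also note N_equiv_\<psi>14[of _ _ _ _ _ _ _ "- k"]
  also note N_equiv_\<psi>43[of _ _ _ _ _ _ _ "- 1"]
  finally show ?thesis by (simp add: algebra_simps)
qed

lemma t2_add_c1:
  "with_ft q x1 x2 x3 x4 y1 y2 \<sim>\<^sub>N with_ft q x1 x2 x3 x4 y1 (y2 + k * c1 q)"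
proof -
  note N_equiv_\<psi>34[of q x1 x2 x3 x4 y1 y2 k]
  also note N_equiv_\<psi>41[of _ _ _ _ _ _ _ 1]
  also note N_equiv_\<psi>34[of _ _ _ _ _ _ _ "- k"]
  also note N_equiv_\<psi>41[of _ _ _ _ _ _ _ "- 1"]
  finally show ?thesis by (simp add: algebra_simps)
qed

lemma t2_add_c4:
  "with_ft q x1 x2 x3 x4 y1 y2 \<sim>\<^sub>N with_ft q x1 x2 x3 x4 y1 (y2 + k * c4 q)"
proof -
  note N_equiv_\<psi>43[of q x1 x2 x3 x4 y1 y2 k]
  also note N_equiv_\<psi>32[of _ _ _ _ _ _ _ 1]
  also note N_equiv_\<psi>43[of _ _ _ _ _ _ _ "- k"]
  also note N_equiv_\<psi>32[of _ _ _ _ _ _ _ "- 1"]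
  finally show ?thesis by (simp add: algebra_simps)
qed

text \<open>Here each move shifts the face number that the other one adds: \<open>\<psi>34\<close>
  shifts \<open>f2\<close> and \<open>\<psi>32\<close> shifts \<open>f4\<close>, both by multiples
  of \<open>c2\<close>. Hence \<open>t1\<close> and \<open>t2\<close> change together, with opposite
  signs.\<close>

lemma t1_t2_add_c2:
  "with_ft q x1 x2 x3 x4 y1 y2 \<sim>\<^sub>N with_ft q x1 x2 x3 x4 (y1 + k * c2 q) (y2 - k * c2 q)"
proof -
  note N_equiv_\<psi>34[of q x1 x2 x3 x4 y1 y2 k]
  also note N_equiv_\<psi>32[of _ _ _ _ _ _ _ 1]
  also note N_equiv_\<psi>34[of _ _ _ _ _ _ _ "- k"]
  also note N_equiv_\<psi>32[of _ _ _ _ _ _ _ "- 1"]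
  finally show ?thesis by (simp add: algebra_simps)
qed

lemma t1_t2_add_c5:
  "with_ft q x1 x2 x3 x4 y1 y2 \<sim>\<^sub>N with_ft q x1 x2 x3 x4 (y1 + k * c5 q) (y2 - k * c5 q)"
proof -
  note N_equiv_\<psi>43[of q x1 x2 x3 x4 y1 y2 k]
  also note N_equiv_\<psi>41[of _ _ _ _ _ _ _ 1]
  also note N_equiv_\<psi>43[of _ _ _ _ _ _ _ "- k"]
  also note N_equiv_\<psi>41[of _ _ _ _ _ _ _ "- 1"]
  finally show ?thesis by (simp add: algebra_simps)
qed

text \<open>Positional instantiation ends with \<open>i\<close>, \<open>l\<close>, \<open>m\<close>,
  \<open>j\<close>, \<open>k\<close>, the coefficients of \<open>c3\<close>, \<open>c5\<close>,
  \<open>c2\<close>, \<open>c1\<close>, \<open>c4\<close>.\<close>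

lemma t_translate:
  "with_ft q x1 x2 x3 x4 y1 y2 \<sim>\<^sub>N
   with_ft q x1 x2 x3 x4
     (y1 + i * c3 q + l * c5 q + m * c2 q) (y2 + j * c1 q + k * c4 q - l * c5 q - m * c2 q)"
proof -
  note t1_add_c3[of q x1 x2 x3 x4 y1 y2 i]
  also note t2_add_c1[of _ _ _ _ _ _ _ j]
  also note t2_add_c4[of _ _ _ _ _ _ _ k]
  also note t1_t2_add_c5[of _ _ _ _ _ _ _ l]
  also note t1_t2_add_c2[of _ _ _ _ _ _ _ m]
  finally show ?thesis by (simp add: algebra_simps)
qed

section \<open>Invariance under moves and a criterion for completeness\<close>

lemma residue_class_eq_iff: "(a modulo m) = (b modulo m) \<longleftrightarrow> [a = b] (mod m)"
  unfolding residue_class_def by (auto intro: cong_sym cong_trans)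

text \<open>\<open>P\<close> is required in both directions because a step of the equivalence may
  traverse a move backwards, and \<open>Q\<close> is controlled only where \<open>P\<close> holds at
  the source of the move.\<close>

lemma N_equiv_invariant:
  assumes "q \<sim>\<^sub>N q'" "P q"
    and P: "\<And>q q'. N_move q q' \<Longrightarrow> P q \<longleftrightarrow> P q'"
    and Q: "\<And>q q'. N_move q q' \<Longrightarrow> P q \<Longrightarrow> Q q = Q q'"
  shows "P q' \<and> Q q = Q q'"
  using assms(1)
proof (induction rule: equivclp_induct)
  case base
  then show ?case using assms(2) by simp
next
  case (step y z)
  then show ?case using P[of y z] Q[of y z] P[of z y] Q[of z y] by auto
qed

text \<open>Completeness splits into matching the face numbers with no control over
  \<open>t1\<close> and \<open>t2\<close>, and then correcting \<open>t1\<close> and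
  \<open>t2\<close> with everything else fixed.\<close>

lemma complete_invariantsI:
  assumes P: "\<And>q q'. N_move q q' \<Longrightarrow> P q \<longleftrightarrow> P q'"
    and Q: "\<And>q q'. N_move q q' \<Longrightarrow> P q \<Longrightarrow> Q q = Q q'"
    and f: "\<And>q q'. P q \<Longrightarrow> P q' \<Longrightarrow> Q q = Q q' \<Longrightarrow> \<exists>x y. q \<sim>\<^sub>N q'\<lparr>t1 := x, t2 := y\<rparr>"
    and t: "\<And>q x y. P q \<Longrightarrow> Q q = Q (q\<lparr>t1 := x, t2 := y\<rparr>) \<Longrightarrow> q \<sim>\<^sub>N q\<lparr>t1 := x, t2 := y\<rparr>"
  shows "complete_invariants P Q"
proof -
  have *: "N_class q = N_class q' \<longleftrightarrow> Q q = Q q'" if "P q" "P q'" for q q'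
    unfolding N_class_eq_iff
  proof
    show "Q q = Q q'" if "q \<sim>\<^sub>N q'"
      using N_equiv_invariant[where P = P and Q = Q, OF that \<open>P q\<close> P Q] by blast
  next
    assume eq: "Q q = Q q'"
    with f that obtain x y where r: "q \<sim>\<^sub>N q'\<lparr>t1 := x, t2 := y\<rparr>" (is "q \<sim>\<^sub>N ?r") by blast
    \<comment> \<open>Invariance along the first stage carries \<open>P\<close> and the value of
      \<open>Q\<close> to the intermediate tuple, so the second stage applies to it.\<close>
    then have "P ?r" "Q q = Q ?r"
      using N_equiv_invariant[where P = P and Q = Q, OF r \<open>P q\<close> P Q] by blast+
    then have "?r \<sim>\<^sub>N ?r\<lparr>t1 := t1 q', t2 := t2 q'\<rparr>"
      using eq by (intro t) simp_all
    with r show "q \<sim>\<^sub>N q'"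
      by (auto intro: N_equiv_trans)
  qed
  then show ?thesis
    unfolding complete_invariants_def by (auto simp: link_homotopic_iff_N_class_eq)
qed

section \<open>Congruences modulo a gcd as integer linear combinations\<close>

lemma cong_mod_gcd_imp_linear_combination:
  fixes a b x y :: int
  assumes "[a = b] (mod gcd x y)"
  obtains u v where "a = b + u * x + v * y"
proof -
  obtain k where k: "a - b = gcd x y * k" using assms unfolding cong_iff_dvd_diff ..
  obtain u v where "u * x + v * y = gcd x y" using bezout_int by blast
  with k have "a - b = (u * x + v * y) * k" by simp
  then have "a = b + (u * k) * x + (v * k) * y" by (simp add: algebra_simps)
  then show thesis by (rule that)
qed

lemma cong_mod_gcd3_imp_linear_combination:
  fixes a b x y z :: int
  assumes "[a = b] (mod gcd x (gcd y z))"
  obtains u v w where "a = b + u * x + v * y + w * z"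
proof -
  obtain u k where "a = b + u * x + k * gcd y z"
    using assms by (rule cong_mod_gcd_imp_linear_combination)
  moreover obtain v w where "k * gcd y z = 0 + v * y + w * z"
    by (rule cong_mod_gcd_imp_linear_combination[of "k * gcd y z" 0 y z]) (simp add: cong_0_iff)
  ultimately have "a = b + u * x + v * y + w * z" by simp
  then show thesis by (rule that)
qed

text \<open>With the face numbers fixed, \<open>\<Delta>1\<close> and \<open>\<Delta>2\<close> are
  affine in \<open>t1\<close> and \<open>t2\<close>; this strips the slope from the value and from
  the modulus.\<close>

lemma cong_mult_add_cancel:
  fixes a x y z m :: int
  assumes "a \<noteq> 0"
  shows "[a * x + z = a * y + z] (mod a * m) \<longleftrightarrow> [x = y] (mod m)"
  using assms by (simp add: cong_iff_dvd_diff flip: right_diff_distrib)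

section \<open>Effect of a single move modulo an integer\<close>

lemma N_moveE:
  assumes "N_move q q'"
  obtains "q' = \<psi>21 q" | "q' = \<psi>41 q" | "q' = \<psi>12 q" | "q' = \<psi>32 q"
    | "q' = \<psi>43 q" | "q' = \<psi>23 q" | "q' = \<psi>34 q" | "q' = \<psi>14 q"
  using assms unfolding N_move_def by blast

lemma N_move_same_c:
  assumes "N_move q q'"
  shows "c1 q' = c1 q" "c2 q' = c2 q" "c3 q' = c3 q" "c4 q' = c4 q" "c5 q' = c5 q" "c6 q' = c6 q"
  by (rule N_moveE[OF assms]; simp add: \<psi>_defs)+

text \<open>The hypotheses list the edge numbers by which some move shifts the given face number.
  The case \<open>m = 0\<close> is allowed and yields equality.\<close>

lemma N_move_cong_f:
  assumes "N_move q q'"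
  shows "m dvd c1 q \<Longrightarrow> m dvd c5 q \<Longrightarrow> m dvd c6 q \<Longrightarrow> [f1 q' = f1 q] (mod m)"
    and "m dvd c2 q \<Longrightarrow> m dvd c4 q \<Longrightarrow> m dvd c6 q \<Longrightarrow> [f2 q' = f2 q] (mod m)"
    and "m dvd c3 q \<Longrightarrow> m dvd c4 q \<Longrightarrow> m dvd c5 q \<Longrightarrow> [f3 q' = f3 q] (mod m)"
    and "m dvd c1 q \<Longrightarrow> m dvd c2 q \<Longrightarrow> m dvd c3 q \<Longrightarrow> [f4 q' = f4 q] (mod m)"
  by (rule N_moveE[OF assms]; simp add: \<psi>_defs cong_iff_dvd_diff)+

text \<open>The quadratic term makes \<open>\<psi>21\<close> and \<open>\<psi>34\<close> preserve
  \<open>\<Delta>1\<close> exactly. The three divisibility hypotheses account for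
  \<open>\<psi>12\<close>, \<open>\<psi>43\<close> and \<open>\<psi>23\<close>.\<close>

lemma N_move_cong_\<Delta>1:
  assumes "N_move q q'" "c2 q = 0" "c4 q = 0" "c5 q = 0" "c6 q = 0"
    and "m dvd c1 q * f2 q" "m dvd c1 q * f3 q" "m dvd c3 q * f1 q"
  shows "[c1 q' * t1 q' + f1 q' * f4 q' = c1 q * t1 q + f1 q * f4 q] (mod m)"
  by (rule N_moveE[OF assms(1)];
      use assms(2-) in \<open>simp add: \<psi>_defs cong_iff_dvd_diff algebra_simps\<close>)

text \<open>Now \<open>\<psi>23\<close> and \<open>\<psi>14\<close> cancel exactly, and
  \<open>\<psi>41\<close>, \<open>\<psi>32\<close>, \<open>\<psi>21\<close> and
  \<open>\<psi>12\<close> account for the four hypotheses in turn.\<close>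

lemma N_move_cong_\<Delta>2:
  assumes "N_move q q'" "c2 q = 0" "c5 q = 0" "c6 q = 0"
    and "m dvd c3 q * f1 q" "m dvd c3 q * f2 q" "m dvd c1 q * f3 q" "m dvd c4 q * f4 q"
  shows "[c3 q' * t2 q' + f3 q' * f4 q' = c3 q * t2 q + f3 q * f4 q] (mod m)"
  by (rule N_moveE[OF assms(1)];
      use assms(2-) in \<open>simp add: \<psi>_defs cong_iff_dvd_diff algebra_simps\<close>)

lemma Gcd_eqI_int:
  fixes A B :: "int set"
  assumes "\<And>d. (\<forall>a\<in>A. d dvd a) \<longleftrightarrow> (\<forall>b\<in>B. d dvd b)"
  shows "Gcd A = Gcd B"
  by (rule associated_eqI; use assms[of "Gcd A"] assms[of "Gcd B"] in \<open>simp add: dvd_Gcd_iff\<close>)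

lemma cong_dvd_iff_of_dvd:
  fixes a b c d :: int
  assumes "[a = b] (mod c)" "d dvd c"
  shows "d dvd a \<longleftrightarrow> d dvd b"
  using assms by (meson cong_dvd_iff cong_dvd_modulus)

section \<open>The five families of tuples\<close>

text \<open>Since \<open>c1\<close> divides \<open>f1\<close> and \<open>c3\<close> divides
  \<open>f3\<close>, both \<open>c1 * f3\<close> and \<open>c3 * f1\<close> are multiples of
  \<open>c1 * c3\<close>, so they vanish modulo either modulus. The same divisibilities let
  \<open>\<psi>34\<close> and \<open>\<psi>14\<close> match \<open>f1\<close> and
  \<open>f3\<close>.\<close>

lemma complete_invariants_c1_c3_dvd:
    "complete_invariants
       (\<lambda>q. c2 q = 0 \<and> c4 q = 0 \<and> c5 q = 0 \<and> c6 q = 0 \<and> c1 q \<noteq> 0 \<and> c3 q \<noteq> 0 \<and>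
            [f1 q = 0] (mod c1 q) \<and> [f3 q = 0] (mod c3 q))
       (\<lambda>q. (c1 q, c3 q, f2 q,
             f4 q modulo gcd (c1 q) (c3 q),
             c1 q * t1 q + f1 q * f4 q modulo c1 q * gcd (c3 q) (f2 q),
             c3 q * t2 q + f3 q * f4 q modulo c3 q * gcd (c1 q) (f2 q)))"
    (is "complete_invariants ?P ?Q")
proof (rule complete_invariantsI)
  fix q q' assume m: "N_move q q'"
  note same_c = N_move_same_c[OF m] and cong_f = N_move_cong_f[OF m]
  show P: "?P q \<longleftrightarrow> ?P q'"
    using cong_f(1)[of "c1 q"] cong_f(3)[of "c3 q"]
    by (auto simp: same_c cong_0_iff cong_dvd_iff)
  assume "?P q"
  then have "f2 q' = f2 q" "[f4 q' = f4 q] (mod gcd (c1 q) (c3 q))"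
    using cong_f(2)[of 0] cong_f(4) by auto
  moreover from \<open>?P q\<close> obtain u v where "f1 q = c1 q * u" "f3 q = c3 q * v"
    by (auto simp: cong_0_iff elim!: dvdE)
  then have "c1 q * gcd (c3 q) (f2 q) dvd c1 q * f3 q" "c1 q * gcd (c3 q) (f2 q) dvd c3 q * f1 q"
    "c3 q * gcd (c1 q) (f2 q) dvd c1 q * f3 q" "c3 q * gcd (c1 q) (f2 q) dvd c3 q * f1 q"
    by (auto simp: mult.left_commute mult.commute[of "c3 q"])
  ultimately show "?Q q = ?Q q'"
    using \<open>?P q\<close> N_move_cong_\<Delta>1[OF m, of "c1 q * gcd (c3 q) (f2 q)"]
      N_move_cong_\<Delta>2[OF m, of "c3 q * gcd (c1 q) (f2 q)"]
    by (simp add: same_c residue_class_eq_iff cong_sym_eq)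
next
  fix q q' assume P: "?P q" "?P q'" and eq: "?Q q = ?Q q'"
  then have c: "c1 q' = c1 q" "c3 q' = c3 q" "f2 q' = f2 q" by simp_all
  have "[f1 q' = f1 q] (mod c1 q)" "[f3 q = f3 q'] (mod c3 q)"
    using P c by (auto intro: cong_trans cong_sym)
  then obtain u v where f: "f1 q = f1 q' + c1 q * u" "f3 q' = f3 q + c3 q * v"
    unfolding cong_iff_lin by blast
  from eq c have "[f4 q' = f4 q] (mod gcd (c1 q) (c3 q))"
    by (simp add: residue_class_eq_iff cong_sym_eq)
  then obtain x y where "f4 q' = f4 q + x * c1 q + y * c3 q"
    by (rule cong_mod_gcd_imp_linear_combination)
  with P c f show "\<exists>x y. q \<sim>\<^sub>N q'\<lparr>t1 := x, t2 := y\<rparr>"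
    by (intro f_translate[of q' q 0 0 y u 0 v "-x" 0]) simp_all
next
  fix q x y assume P: "?P q" and eq: "?Q q = ?Q (q\<lparr>t1 := x, t2 := y\<rparr>)"
  then have "[x = t1 q] (mod gcd (c3 q) (f2 q))" "[y = t2 q] (mod gcd (c1 q) (f2 q))"
    by (simp_all add: residue_class_eq_iff cong_mult_add_cancel cong_sym_eq)
  then obtain a b a' b' where
    t: "x = t1 q + a * c3 q + b * f2 q" "y = t2 q + a' * c1 q + b' * f2 q"
    by (metis cong_mod_gcd_imp_linear_combination)
  \<comment> \<open>As \<open>c2\<close>, \<open>c4\<close> and \<open>c6\<close> vanish,
    \<open>\<psi>12\<close> and \<open>\<psi>32\<close> change only \<open>t1\<close> and
    \<open>t2\<close>, by multiples of \<open>f2\<close>.\<close>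
  note t_translate[of q "f1 q" "f2 q" "f3 q" "f4 q" "t1 q" "t2 q" a 0 0 a' 0]
  also note N_equiv_\<psi>12[of _ _ _ _ _ _ _ b]
  also note N_equiv_\<psi>32[of _ _ _ _ _ _ _ "- b'"]
  finally show "q \<sim>\<^sub>N q\<lparr>t1 := x, t2 := y\<rparr>"
    using P t by (simp add: with_ft_eq_update_t)
qed

text \<open>The available translations are by \<open>c1\<close>, \<open>f2\<close>,
  \<open>f3\<close> in \<open>t1\<close> and by \<open>c1\<close>, \<open>f1\<close>,
  \<open>f2\<close> in \<open>t2\<close>. The hypotheses on \<open>f1\<close> and \<open>f3\<close>
  make both gcds equal to the gcd of all four numbers, which is the common modulus.\<close>

lemma complete_invariants_c1_eq_c3:
    "complete_invariants
       (\<lambda>q. c2 q = 0 \<and> c4 q = 0 \<and> c5 q = 0 \<and> c6 q = 0 \<and> c1 q = c3 q \<and> c3 q \<noteq> 0 \<and>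
            [f1 q = 0] (mod Gcd {c1 q, f2 q, f3 q}) \<and> [f3 q = 0] (mod Gcd {c1 q, f1 q, f2 q}))
       (\<lambda>q. (c1 q,
             f1 q modulo c1 q,
             f3 q modulo c1 q,
             f2 q,
             f4 q modulo c1 q,
             c1 q * t1 q + f1 q * f4 q modulo c1 q * Gcd {c1 q, f1 q, f2 q, f3 q},
             c1 q * t2 q + f3 q * f4 q modulo c1 q * Gcd {c1 q, f1 q, f2 q, f3 q}))"
    (is "complete_invariants ?P ?Q")
proof -
  \<comment> \<open>The moves shift \<open>f1\<close> and \<open>f3\<close> by multiples of
    \<open>c1\<close>, so neither the moduli nor the hypotheses change.\<close>
  have Gcds:
    "Gcd {c1 q', f1 q', f2 q', f3 q'} = Gcd {c1 q, f1 q, f2 q, f3 q}"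
    "Gcd {c1 q', f2 q', f3 q'} = Gcd {c1 q, f2 q, f3 q}"
    "Gcd {c1 q', f1 q', f2 q'} = Gcd {c1 q, f1 q, f2 q}"
    if "c1 q' = c1 q" "f2 q' = f2 q" "[f1 q' = f1 q] (mod c1 q)" "[f3 q' = f3 q] (mod c1 q)"
    for q q'
    by (rule Gcd_eqI_int, simp add: that(1,2) cong_dvd_iff_of_dvd[OF that(3)]
          cong_dvd_iff_of_dvd[OF that(4)] cong: conj_cong)+
  show ?thesis
  proof (rule complete_invariantsI)
    fix q q' assume m: "N_move q q'"
    let ?c0 = "c2 q = 0 \<and> c4 q = 0 \<and> c5 q = 0 \<and> c6 q = 0 \<and> c1 q = c3 q"
    note same_c = N_move_same_c[OF m] and cong_f = N_move_cong_f[OF m]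
    have f: "f2 q' = f2 q" "[f1 q' = f1 q] (mod c1 q)" "[f3 q' = f3 q] (mod c1 q)"
        "[f4 q' = f4 q] (mod c1 q)" if ?c0
      using that cong_f(1)[of "c1 q"] cong_f(2)[of 0] cong_f(3)[of "c1 q"] cong_f(4)[of "c1 q"]
      by simp_all
    note Gcds = Gcds[of q' q, OF same_c(1) f(1-3)]
    show "?P q \<longleftrightarrow> ?P q'"
    \<comment> \<open>Invariance of the gcds relies on the vanishing edge numbers. Otherwise both
      sides are false, as moves keep the edge numbers.\<close>
    proof (cases ?c0)
      case True
      have "Gcd {c1 q, f2 q, f3 q} dvd f1 q' \<longleftrightarrow> Gcd {c1 q, f2 q, f3 q} dvd f1 q"
          "Gcd {c1 q, f1 q, f2 q} dvd f3 q' \<longleftrightarrow> Gcd {c1 q, f1 q, f2 q} dvd f3 q"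
        by (rule cong_dvd_iff_of_dvd, rule f[OF True], rule Gcd_dvd, simp)+
      then show ?thesis
        unfolding Gcds(2,3)[OF True True True] unfolding same_c cong_0_iff by argo
    next
      case False
      then show ?thesis by (auto simp: same_c)
    qed
    assume P: "?P q"
    then have ?c0 by simp
    note f = f[OF this] and Gcds = Gcds[OF this this this]
    let ?m = "c1 q * Gcd {c1 q, f1 q, f2 q, f3 q}"
    have "?m dvd c1 q * f1 q" "?m dvd c1 q * f2 q" "?m dvd c1 q * f3 q"
      by (rule mult_dvd_mono[OF dvd_refl Gcd_dvd], simp)+
    with \<open>?c0\<close> have
      "[c1 q' * t1 q' + f1 q' * f4 q' = c1 q * t1 q + f1 q * f4 q] (mod ?m)"
      "[c3 q' * t2 q' + f3 q' * f4 q' = c3 q * t2 q + f3 q * f4 q] (mod ?m)"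
      using N_move_cong_\<Delta>1[OF m, of ?m] N_move_cong_\<Delta>2[OF m, of ?m] by auto
    with f \<open>?c0\<close> show "?Q q = ?Q q'"
      unfolding Gcds unfolding same_c by (simp add: residue_class_eq_iff cong_sym_eq)
  next
    fix q q' assume P: "?P q" "?P q'" and eq: "?Q q = ?Q q'"
    from eq have c: "c1 q' = c1 q" "f2 q' = f2 q" by simp_all
    from eq c have "[f1 q' = f1 q] (mod c1 q)" "[f3 q = f3 q'] (mod c1 q)" "[f4 q = f4 q'] (mod c1 q)"
      by (simp_all add: residue_class_eq_iff cong_sym_eq)
    then obtain a b d where "f1 q = f1 q' + c1 q * a" "f3 q' = f3 q + c1 q * b"
        "f4 q' = f4 q + c1 q * d"
      unfolding cong_iff_lin by blast
    with P c show "\<exists>x y. q \<sim>\<^sub>N q'\<lparr>t1 := x, t2 := y\<rparr>"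
      by (intro f_translate[of q' q 0 0 0 a 0 b "- d" 0]) (simp_all add: mult.commute)
  next
    fix q x y assume P: "?P q" and eq: "?Q q = ?Q (q\<lparr>t1 := x, t2 := y\<rparr>)"
    from P have "[f1 q = 0] (mod Gcd {c1 q, f2 q, f3 q})" "[f3 q = 0] (mod Gcd {c1 q, f1 q, f2 q})"
      by blast+
    then have "gcd (c1 q) (gcd (f2 q) (f3 q)) dvd f1 q"
        "gcd (c1 q) (gcd (f1 q) (f2 q)) dvd f3 q"
      by (simp_all add: cong_0_iff)
    then have "gcd (f1 q) (gcd (c1 q) (gcd (f2 q) (f3 q))) = gcd (c1 q) (gcd (f2 q) (f3 q))"
        "gcd (gcd (c1 q) (gcd (f1 q) (f2 q))) (f3 q) = gcd (c1 q) (gcd (f1 q) (f2 q))"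
      by (simp_all add: gcd_proj1_if_dvd gcd_proj2_if_dvd)
    then have "Gcd {c1 q, f1 q, f2 q, f3 q} = gcd (c1 q) (gcd (f2 q) (f3 q))"
        "Gcd {c1 q, f1 q, f2 q, f3 q} = gcd (c1 q) (gcd (f1 q) (f2 q))"
      by (simp_all add: gcd.assoc gcd.left_commute[of "f1 q" "c1 q"])
    with eq P have cong: "[x = t1 q] (mod gcd (c1 q) (gcd (f2 q) (f3 q)))"
        "[y = t2 q] (mod gcd (c1 q) (gcd (f1 q) (f2 q)))"
      by (simp_all add: residue_class_eq_iff cong_mult_add_cancel cong_sym_eq del: Gcd_insert)
    obtain a b d where t1: "x = t1 q + a * c1 q + b * f2 q + d * f3 q"
      using cong(1) by (rule cong_mod_gcd3_imp_linear_combination)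
    obtain a' b' d' where t2: "y = t2 q + a' * c1 q + b' * f1 q + d' * f2 q"
      using cong(2) by (rule cong_mod_gcd3_imp_linear_combination)
    note t_translate[of q "f1 q" "f2 q" "f3 q" "f4 q" "t1 q" "t2 q" a 0 0 a' 0]
    also note N_equiv_\<psi>12[of _ _ _ _ _ _ _ b]
    also note N_equiv_\<psi>43[of _ _ _ _ _ _ _ d]
    also note N_equiv_\<psi>41[of _ _ _ _ _ _ _ "- b'"]
    also note N_equiv_\<psi>32[of _ _ _ _ _ _ _ "- d'"]
    finally show "q \<sim>\<^sub>N q\<lparr>t1 := x, t2 := y\<rparr>"
      using P t1 t2 by (simp add: with_ft_eq_update_t)
  qed
qed

text \<open>Coprimality makes \<open>f3\<close> and \<open>f4\<close> freely adjustable, so they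
  occur only inside \<open>\<Delta>2\<close> and \<open>\<Delta>3\<close>. With the face numbers
  fixed, \<open>t1\<close> moves by \<open>c3\<close>, and \<open>t2\<close> by \<open>c1\<close>,
  \<open>c4\<close>, \<open>f1\<close> and \<open>f2\<close>.\<close>

lemma complete_invariants_c1_c3_c4:
    "complete_invariants
       (\<lambda>q. c2 q = 0 \<and> c5 q = 0 \<and> c6 q = 0 \<and> c1 q \<noteq> 0 \<and> c3 q \<noteq> 0 \<and> c4 q \<noteq> 0 \<and>
            gcd (c1 q) (c3 q) = 1 \<and> gcd (c3 q) (c4 q) = 1)
       (\<lambda>q. (c1 q, c3 q, c4 q,
             f1 q modulo c1 q,
             f2 q modulo c4 q,
             c3 q * t2 q + f3 q * f4 q modulo Gcd {c1 q, c4 q, c3 q * f1 q, c3 q * f2 q},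
             c1 q * c4 q * t1 q + c4 q * f1 q * f4 q + c1 q * f2 q * f3 q modulo c3 q))"
    (is "complete_invariants ?P ?Q")
proof -
  let ?M = "\<lambda>q. Gcd {c1 q, c4 q, c3 q * f1 q, c3 q * f2 q}"
  have Gcd_cong: "?M q' = ?M q"
    if "c1 q' = c1 q" "c3 q' = c3 q" "c4 q' = c4 q"
      "[f1 q' = f1 q] (mod c1 q)" "[f2 q' = f2 q] (mod c4 q)" for q q'
    by (rule Gcd_eqI_int, simp add: that(1-3) cong_dvd_iff_of_dvd[OF cong_scalar_left[OF that(4)]]
          cong_dvd_iff_of_dvd[OF cong_scalar_left[OF that(5)]] cong: conj_cong)
  show ?thesis
  proof (rule complete_invariantsI)
    fix q q' assume m: "N_move q q'"
    note same_c = N_move_same_c[OF m] and cong_f = N_move_cong_f[OF m]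
    show "?P q \<longleftrightarrow> ?P q'"
      by (simp add: same_c)
    assume P: "?P q"
    have f: "[f1 q' = f1 q] (mod c1 q)" "[f2 q' = f2 q] (mod c4 q)"
      using P cong_f(1)[of "c1 q"] cong_f(2)[of "c4 q"] by simp_all
    note M = Gcd_cong[of q' q, OF same_c(1,3,4) f]
    have dvd: "?M q dvd c1 q" "?M q dvd c4 q" "?M q dvd c3 q * f1 q" "?M q dvd c3 q * f2 q"
      by (rule Gcd_dvd, simp)+
    have "[c3 q' * t2 q' + f3 q' * f4 q' = c3 q * t2 q + f3 q * f4 q] (mod ?M q)"
      by (rule N_move_cong_\<Delta>2[OF m _ _ _ dvd(3,4) dvd_mult2[OF dvd(1)] dvd_mult2[OF dvd(2)]])
        (use P in simp_all)
    moreover have "[c1 q' * c4 q' * t1 q' + c4 q' * f1 q' * f4 q' + c1 q' * f2 q' * f3 q' =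
        c1 q * c4 q * t1 q + c4 q * f1 q * f4 q + c1 q * f2 q * f3 q] (mod c3 q)"
      by (rule N_moveE[OF m];
          use P in \<open>simp add: \<psi>_defs cong_iff_dvd_diff algebra_simps\<close>)
    ultimately show "?Q q = ?Q q'"
      using f unfolding M unfolding same_c by (simp add: residue_class_eq_iff cong_sym_eq)
  next
    fix q q' assume P: "?P q" "?P q'" and eq: "?Q q = ?Q q'"
    from eq have c: "c1 q' = c1 q" "c3 q' = c3 q" "c4 q' = c4 q" by simp_all
    from eq c have "[f1 q' = f1 q] (mod c1 q)" "[f2 q' = f2 q] (mod c4 q)"
      by (simp_all add: residue_class_eq_iff cong_sym_eq)
    then obtain a b where "f1 q = f1 q' + c1 q * a" "f2 q = f2 q' + c4 q * b"
      unfolding cong_iff_lin by blast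
    moreover obtain d e where "f3 q' = f3 q + d * c3 q + e * c4 q"
      by (rule cong_mod_gcd_imp_linear_combination[of "f3 q'" "f3 q" "c3 q" "c4 q"]) (use P in auto)
    moreover obtain g h where "f4 q' = f4 q + g * c1 q + h * c3 q"
      by (rule cong_mod_gcd_imp_linear_combination[of "f4 q'" "f4 q" "c1 q" "c3 q"]) (use P in auto)
    ultimately show "\<exists>x y. q \<sim>\<^sub>N q'\<lparr>t1 := x, t2 := y\<rparr>"
      using P c by (intro f_translate[of q' q 0 b h a 0 d "- g" "- e"]) simp_all
  next
    fix q x y assume P: "?P q" and eq: "?Q q = ?Q (q\<lparr>t1 := x, t2 := y\<rparr>)"
    then have "[c1 q * c4 q * x = c1 q * c4 q * t1 q] (mod c3 q)"
      by (simp add: residue_class_eq_iff cong_add_rcancel cong_sym_eq)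
    moreover have "coprime (c1 q * c4 q) (c3 q)"
      using P by (metis coprime_commute coprime_iff_gcd_eq_1 coprime_mult_left_iff)
    ultimately have "[x = t1 q] (mod c3 q)"
      by (simp add: cong_mult_lcancel)
    then obtain i where t1: "x = t1 q + c3 q * i"
      using cong_iff_lin cong_sym by blast
    \<comment> \<open>\<open>?g\<close> generates the available translations of \<open>t2\<close>.
      It divides the modulus of \<open>\<Delta>2\<close>, and \<open>c3\<close> can be cancelled
      modulo \<open>?g\<close> because \<open>?g\<close> divides \<open>c1\<close>.\<close>
    let ?g = "gcd (c1 q) (gcd (c4 q) (gcd (f1 q) (f2 q)))"
    have "?g dvd ?M q"
      by (simp add: dvd_mult gcd_dvdI2)
    moreover have "[c3 q * y = c3 q * t2 q] (mod ?M q)"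
      using eq by (simp add: residue_class_eq_iff cong_add_rcancel cong_sym_eq del: Gcd_insert)
    ultimately have "[c3 q * y = c3 q * t2 q] (mod ?g)"
      using cong_dvd_modulus by blast
    moreover have "coprime (c3 q) ?g"
      using P by (metis coprime_divisors coprime_iff_gcd_eq_1 dvd_refl gcd.commute gcd_dvd1)
    ultimately have "[y = t2 q] (mod ?g)"
      by (simp add: cong_mult_lcancel)
    then obtain j k n where "y = t2 q + j * c1 q + k * c4 q + n * gcd (f1 q) (f2 q)"
      by (rule cong_mod_gcd3_imp_linear_combination)
    moreover obtain a b where "n * gcd (f1 q) (f2 q) = 0 + a * f1 q + b * f2 q"
      by (rule cong_mod_gcd_imp_linear_combination[of "n * gcd (f1 q) (f2 q)" 0 "f1 q" "f2 q"])
        (simp add: cong_0_iff)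
    ultimately have t2: "y = t2 q + j * c1 q + k * c4 q + a * f1 q + b * f2 q"
      by simp
    note t_translate[of q "f1 q" "f2 q" "f3 q" "f4 q" "t1 q" "t2 q" i 0 0 j k]
    also note N_equiv_\<psi>41[of _ _ _ _ _ _ _ "- a"]
    also note N_equiv_\<psi>32[of _ _ _ _ _ _ _ "- b"]
    finally show "q \<sim>\<^sub>N q\<lparr>t1 := x, t2 := y\<rparr>"
      using P t1 t2 by (simp add: with_ft_eq_update_t mult.commute)
  qed
qed

text \<open>The commutators alone reach every pair \<open>(t1, t2)\<close>, so only the face numbers
  carry information.\<close>

lemma complete_invariants_c1_c2_c4_c5:
    "complete_invariants
       (\<lambda>q. c3 q = 0 \<and> c6 q = 0 \<and> c1 q \<noteq> 0 \<and> c2 q \<noteq> 0 \<and> c4 q \<noteq> 0 \<and> c5 q \<noteq> 0 \<and>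
            gcd (c1 q) (c4 q) = 1 \<and> gcd (c2 q) (c5 q) = 1)
       (\<lambda>q. (c1 q, c2 q, c4 q, c5 q,
             f1 q modulo gcd (c1 q) (c5 q),
             f2 q modulo gcd (c2 q) (c4 q),
             f3 q modulo gcd (c4 q) (c5 q),
             f4 q modulo gcd (c1 q) (c2 q)))"
    (is "complete_invariants ?P ?Q")
proof (rule complete_invariantsI)
  fix q q' assume m: "N_move q q'"
  note same_c = N_move_same_c[OF m] and cong_f = N_move_cong_f[OF m]
  show "?P q \<longleftrightarrow> ?P q'"
    by (simp add: same_c)
  assume "?P q"
  then show "?Q q = ?Q q'"
    by (simp add: same_c residue_class_eq_iff cong_f cong_sym)
next
  fix q q' assume P: "?P q" "?P q'" and eq: "?Q q = ?Q q'"
  from eq have c: "c1 q' = c1 q" "c2 q' = c2 q" "c4 q' = c4 q" "c5 q' = c5 q" by simp_all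
  from eq c have
    cong: "[f1 q' = f1 q] (mod gcd (c1 q) (c5 q))" "[f2 q' = f2 q] (mod gcd (c2 q) (c4 q))"
      "[f3 q' = f3 q] (mod gcd (c4 q) (c5 q))" "[f4 q' = f4 q] (mod gcd (c1 q) (c2 q))"
    by (simp_all add: residue_class_eq_iff cong_sym_eq)
  obtain a1 b1 where f1: "f1 q' = f1 q + a1 * c1 q + b1 * c5 q"
    using cong(1) by (rule cong_mod_gcd_imp_linear_combination)
  obtain a2 b2 where f2: "f2 q' = f2 q + a2 * c2 q + b2 * c4 q"
    using cong(2) by (rule cong_mod_gcd_imp_linear_combination)
  obtain a3 b3 where f3: "f3 q' = f3 q + a3 * c4 q + b3 * c5 q"
    using cong(3) by (rule cong_mod_gcd_imp_linear_combination)
  obtain a4 b4 where f4: "f4 q' = f4 q + a4 * c1 q + b4 * c2 q"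
    using cong(4) by (rule cong_mod_gcd_imp_linear_combination)
  \<comment> \<open>The exponents of \<open>\<psi>43\<close>, \<open>\<psi>34\<close>,
    \<open>\<psi>21\<close>, \<open>\<psi>12\<close> produce the terms with \<open>b2\<close>,
    \<open>a1\<close>, \<open>a4\<close>, \<open>a3\<close>. Those of \<open>\<psi>23\<close>,
    \<open>\<psi>14\<close>, \<open>\<psi>41\<close>, \<open>\<psi>32\<close> cancel the side
    effects of these and add the terms with \<open>b1\<close>, \<open>a2\<close>, \<open>b3\<close>,
    \<open>b4\<close>.\<close>
  show "\<exists>x y. q \<sim>\<^sub>N q'\<lparr>t1 := x, t2 := y\<rparr>"
    by (rule f_translate[of q' q "- a3 - b4" "- b2" "- b2 - b1" "- a1" "- a4 - b3" "- a1 - a2"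
          "- a4" "- a3"])
      (use P c f1 f2 f3 f4 in \<open>simp_all add: algebra_simps\<close>)
next
  fix q x y assume P: "?P q"
  obtain l m where t1: "x = t1 q + l * c5 q + m * c2 q"
    by (rule cong_mod_gcd_imp_linear_combination[of x "t1 q" "c5 q" "c2 q"])
      (use P in \<open>auto simp: gcd.commute\<close>)
  \<comment> \<open>Fixing \<open>t1\<close> first shifts \<open>t2\<close> by the opposite amount;
    \<open>c1\<close> and \<open>c4\<close>, being coprime, then correct \<open>t2\<close>
    alone.\<close>
  obtain j k where t2: "y = t2 q - l * c5 q - m * c2 q + j * c1 q + k * c4 q"
    by (rule cong_mod_gcd_imp_linear_combination[of y "t2 q - l * c5 q - m * c2 q" "c1 q" "c4 q"])
      (use P in auto)
  have "y = t2 q + j * c1 q + k * c4 q - l * c5 q - m * c2 q"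
    using t2 by simp
  then show "q \<sim>\<^sub>N q\<lparr>t1 := x, t2 := y\<rparr>"
    using t_translate[of q "f1 q" "f2 q" "f3 q" "f4 q" "t1 q" "t2 q" 0 l m j k] t1
    by (simp add: with_ft_eq_update_t)
qed

text \<open>Once \<open>f1\<close> and \<open>f2\<close> are matched, \<open>f3\<close> remains to
  be compared modulo \<open>c4\<close>. \<open>\<Delta>4\<close> detects exactly this, because
  \<open>c2\<close> is invertible modulo \<open>c4\<close>. The numbers \<open>f4\<close>,
  \<open>t1\<close> and \<open>t2\<close> can be adjusted freely.\<close>

lemma complete_invariants_c1_c2_c3_c4:
    "complete_invariants
       (\<lambda>q. c5 q = 0 \<and> c6 q = 0 \<and> c1 q \<noteq> 0 \<and> c2 q \<noteq> 0 \<and> c3 q \<noteq> 0 \<and> c4 q \<noteq> 0 \<and>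
            ((gcd (c1 q) (c4 q) = 1 \<and> gcd (c2 q) (c3 q) = 1 \<and> gcd (c2 q) (c4 q) = 1) \<or>
             (gcd (c1 q) (c3 q) = 1 \<and> gcd (c2 q) (c3 q) = 1 \<and> gcd (c2 q) (c4 q) = 1)))
       (\<lambda>q. (c1 q, c2 q, c3 q, c4 q,
             f1 q modulo c1 q,
             c1 q * c2 q * f3 q + c1 q * c3 q * f2 q + c2 q * c3 q * f1 q modulo c1 q * c4 q))"
    (is "complete_invariants ?P ?Q")
proof (rule complete_invariantsI)
  fix q q' assume m: "N_move q q'"
  note same_c = N_move_same_c[OF m] and cong_f = N_move_cong_f[OF m]
  show "?P q \<longleftrightarrow> ?P q'"
    by (simp add: same_c)
  assume P: "?P q"
  then have "[f1 q' = f1 q] (mod c1 q)"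
    using cong_f(1)[of "c1 q"] by simp
  moreover have "[c1 q' * c2 q' * f3 q' + c1 q' * c3 q' * f2 q' + c2 q' * c3 q' * f1 q' =
      c1 q * c2 q * f3 q + c1 q * c3 q * f2 q + c2 q * c3 q * f1 q] (mod c1 q * c4 q)"
    by (rule N_moveE[OF m]; use P in \<open>simp add: \<psi>_defs cong_iff_dvd_diff algebra_simps\<close>)
  ultimately show "?Q q = ?Q q'"
    by (simp add: same_c residue_class_eq_iff cong_sym_eq)
next
  fix q q' assume P: "?P q" "?P q'" and eq: "?Q q = ?Q q'"
  from eq have c: "c1 q' = c1 q" "c2 q' = c2 q" "c3 q' = c3 q" "c4 q' = c4 q" by simp_all
  from eq c have "[f1 q' = f1 q] (mod c1 q)"
    by (simp add: residue_class_eq_iff cong_sym_eq)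
  then obtain u where f1: "f1 q = f1 q' + c1 q * u"
    unfolding cong_iff_lin by blast
  \<comment> \<open>The base value includes \<open>u * c2 q\<close>, the side effect on
    \<open>f2\<close> of matching \<open>f1\<close> by \<open>\<psi>34\<close>.\<close>
  obtain a b where f2: "f2 q' = f2 q + u * c2 q + a * c2 q + b * c4 q"
    by (rule cong_mod_gcd_imp_linear_combination[of "f2 q'" "f2 q + u * c2 q" "c2 q" "c4 q"])
      (use P in auto)
  have "c1 q * c4 q dvd (c1 q * c2 q * f3 q' + c1 q * c3 q * f2 q' + c2 q * c3 q * f1 q') -
      (c1 q * c2 q * f3 q + c1 q * c3 q * f2 q + c2 q * c3 q * f1 q)"
    using eq c by (simp add: residue_class_eq_iff cong_sym_eq flip: cong_iff_dvd_diff)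
  \<comment> \<open>The terms in \<open>u\<close> cancel, and \<open>f3 q - a * c3 q\<close> is the
    value left by the power of \<open>\<psi>14\<close> that matches \<open>f2\<close>.\<close>
  also have "\<dots> = c1 q * (c2 q * (f3 q' - (f3 q - a * c3 q)) + c4 q * (b * c3 q))"
    unfolding f1 f2 by (simp add: algebra_simps)
  finally have "c4 q dvd c2 q * (f3 q' - (f3 q - a * c3 q))"
    using P by (simp add: dvd_add_left_iff)
  moreover have "coprime (c4 q) (c2 q)"
    using P by (auto simp: coprime_iff_gcd_eq_1 gcd.commute)
  ultimately have "c4 q dvd f3 q' - (f3 q - a * c3 q)"
    by (simp add: coprime_dvd_mult_right_iff)
  then obtain w where "f3 q' - (f3 q - a * c3 q) = c4 q * w" ..
  then have f3: "f3 q' = f3 q - a * c3 q + c4 q * w" by simp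
  obtain d e where f4: "f4 q' = f4 q + d * c2 q + e * c3 q"
    by (rule cong_mod_gcd_imp_linear_combination[of "f4 q'" "f4 q" "c2 q" "c3 q"])
      (use P in auto)
  \<comment> \<open>The summand \<open>- w\<close> in the exponent of \<open>\<psi>32\<close> undoes
    the effect on \<open>f4\<close> of the power of \<open>\<psi>12\<close> that corrects
    \<open>f3\<close>.\<close>
  show "\<exists>x y. q \<sim>\<^sub>N q'\<lparr>t1 := x, t2 := y\<rparr>"
    by (rule f_translate[of q' q "- w - d" "- b" e u 0 "- a" 0 "- w"])
      (use P c f1 f2 f3 f4 in \<open>simp_all add: algebra_simps\<close>)
next
  fix q x y assume P: "?P q"
  obtain i m where t1: "x = t1 q + i * c3 q + m * c2 q"
    by (rule cong_mod_gcd_imp_linear_combination[of x "t1 q" "c3 q" "c2 q"])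
      (use P in \<open>auto simp: gcd.commute\<close>)
  \<comment> \<open>With \<open>t1\<close> kept fixed, \<open>t2\<close> can still move by
    \<open>c1\<close>, by \<open>c4\<close>, and by \<open>c2 * c3\<close>, the last by trading
    multiples of \<open>(c3, 0)\<close> against multiples of \<open>(c2, -c2)\<close>. Under either
    alternative of the hypothesis these three have gcd 1.\<close>
  have "coprime (c2 q) (gcd (c1 q) (c4 q))" "coprime (c3 q) (gcd (c1 q) (c4 q))"
    using P by (metis coprime_divisors coprime_iff_gcd_eq_1 dvd_refl gcd.commute gcd_dvd1 coprime_1_right)+
  then have "gcd (c2 q * c3 q) (gcd (c1 q) (c4 q)) = 1"
    by (simp flip: coprime_iff_gcd_eq_1)
  then obtain n j k where
    t2: "y = t2 q - m * c2 q + n * (c2 q * c3 q) + j * c1 q + k * c4 q"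
    using cong_mod_gcd3_imp_linear_combination[of y "t2 q - m * c2 q" "c2 q * c3 q" "c1 q" "c4 q"]
    by (metis cong_1)
  have "x = t1 q + (i + n * c2 q) * c3 q + (m - n * c3 q) * c2 q"
    "y = t2 q + j * c1 q + k * c4 q - (m - n * c3 q) * c2 q"
    using t1 t2 by (simp_all add: algebra_simps)
  then show "q \<sim>\<^sub>N q\<lparr>t1 := x, t2 := y\<rparr>"
    using t_translate[of q "f1 q" "f2 q" "f3 q" "f4 q" "t1 q" "t2 q" "i + n * c2 q" 0 "m - n * c3 q" j k]
      P
    by (simp add: with_ft_eq_update_t)
qed

theorem proposition4p3:
  shows
    "complete_invariants
       (\<lambda>q. c2 q = 0 \<and> c4 q = 0 \<and> c5 q = 0 \<and> c6 q = 0 \<and> c1 q \<noteq> 0 \<and> c3 q \<noteq> 0 \<and>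
            [f1 q = 0] (mod c1 q) \<and> [f3 q = 0] (mod c3 q))
       (\<lambda>q. (c1 q, c3 q, f2 q,
             f4 q modulo gcd (c1 q) (c3 q),
             c1 q * t1 q + f1 q * f4 q modulo c1 q * gcd (c3 q) (f2 q),
             c3 q * t2 q + f3 q * f4 q modulo c3 q * gcd (c1 q) (f2 q)))
     \<and>
     complete_invariants
       (\<lambda>q. c2 q = 0 \<and> c4 q = 0 \<and> c5 q = 0 \<and> c6 q = 0 \<and> c1 q = c3 q \<and> c3 q \<noteq> 0 \<and>
            [f1 q = 0] (mod Gcd {c1 q, f2 q, f3 q}) \<and> [f3 q = 0] (mod Gcd {c1 q, f1 q, f2 q}))
       (\<lambda>q. (c1 q,
             f1 q modulo c1 q,
             f3 q modulo c1 q,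
             f2 q,
             f4 q modulo c1 q,
             c1 q * t1 q + f1 q * f4 q modulo c1 q * Gcd {c1 q, f1 q, f2 q, f3 q},
             c1 q * t2 q + f3 q * f4 q modulo c1 q * Gcd {c1 q, f1 q, f2 q, f3 q}))
     \<and>
     complete_invariants
       (\<lambda>q. c2 q = 0 \<and> c5 q = 0 \<and> c6 q = 0 \<and> c1 q \<noteq> 0 \<and> c3 q \<noteq> 0 \<and> c4 q \<noteq> 0 \<and>
            gcd (c1 q) (c3 q) = 1 \<and> gcd (c3 q) (c4 q) = 1)
       (\<lambda>q. (c1 q, c3 q, c4 q,
             f1 q modulo c1 q,
             f2 q modulo c4 q,
             c3 q * t2 q + f3 q * f4 q modulo Gcd {c1 q, c4 q, c3 q * f1 q, c3 q * f2 q},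
             c1 q * c4 q * t1 q + c4 q * f1 q * f4 q + c1 q * f2 q * f3 q modulo c3 q))
     \<and>
     complete_invariants
       (\<lambda>q. c3 q = 0 \<and> c6 q = 0 \<and> c1 q \<noteq> 0 \<and> c2 q \<noteq> 0 \<and> c4 q \<noteq> 0 \<and> c5 q \<noteq> 0 \<and>
            gcd (c1 q) (c4 q) = 1 \<and> gcd (c2 q) (c5 q) = 1)
       (\<lambda>q. (c1 q, c2 q, c4 q, c5 q,
             f1 q modulo gcd (c1 q) (c5 q),
             f2 q modulo gcd (c2 q) (c4 q),
             f3 q modulo gcd (c4 q) (c5 q),
             f4 q modulo gcd (c1 q) (c2 q)))
     \<and>
     complete_invariants
       (\<lambda>q. c5 q = 0 \<and> c6 q = 0 \<and> c1 q \<noteq> 0 \<and> c2 q \<noteq> 0 \<and> c3 q \<noteq> 0 \<and> c4 q \<noteq> 0 \<and>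
            ((gcd (c1 q) (c4 q) = 1 \<and> gcd (c2 q) (c3 q) = 1 \<and> gcd (c2 q) (c4 q) = 1) \<or>
             (gcd (c1 q) (c3 q) = 1 \<and> gcd (c2 q) (c3 q) = 1 \<and> gcd (c2 q) (c4 q) = 1)))
       (\<lambda>q. (c1 q, c2 q, c3 q, c4 q,
             f1 q modulo c1 q,
             c1 q * c2 q * f3 q + c1 q * c3 q * f2 q + c2 q * c3 q * f1 q modulo c1 q * c4 q))"
  by (intro conjI complete_invariants_c1_c3_dvd complete_invariants_c1_eq_c3 complete_invariants_c1_c3_c4 complete_invariants_c1_c2_c4_c5 complete_invariants_c1_c2_c3_c4)

end
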